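(* Let $X$ and $Y$ be CKL-algebras such that $Y$ operates on $X$ via $\rho$ as CKL-algebras. For an ideal $L$ of the symmetric semidirect product $X\bowtie_\rho Y$ put $L_X=\{x\in X\mid (x,1)\in L\}$, $L_Y=\{y\in Y\mid(1,y)\in L\}$ and $$\widetilde L=L_X\rtimes_{\rho|_{L_Y}}L_Y=L_X\times L_Y\subseteq X\rtimes_\rho Y.$$ Then the assignments $L\mapsto\widetilde L$ and $K\mapsto K\cap(X\bowtie_\rho Y)$ establish a bijective correspondence (inverse to each other) between the ideals of the symmetric semidirect product $X\bowtie_\rho Y$ and the ideals of the semidirect product $X\rtimes_\rho Y$.
   Context: An L-algebra is a set $X$ with a binary operation $\cdot$ and a distinguished element $1$ such that for all $x,y,z\in X$: $1\cdot x=x$ and $x\cdot 1=x\cdot x=1$; $(x\cdot y)\cdot(x\cdot z)=(y\cdot x)\cdot(y\cdot z)$; and $x\cdot y=y\cdot x=1$ implies $x=y$. A CKL-algebra is an L-algebra with $x\cdot(y\cdot z)=y\cdot(x\cdot z)$ for all $x,y,z$. $\mathrm{End}(X)$ is the set of maps $f:X\to X$ with $f(x\cdot y)=f(x)\cdot f(y)$. An ideal of an L-algebra $X$ is a nonempty subset $I\subseteq X$ such that for all $x\in I$, $y\in X$: (I1) $x\cdot y\in I$ implies $y\in I$; (I2) $y\cdot x\in I$; (I3) $(x\cdot y)\cdot y\in I$; (I4) $y\cdot(x\cdot y)\in I$. An L-algebra $Y$ operates on an L-algebra $X$ via $\rho:Y\to\mathrm{End}(X)$ if $\rho_1=\mathrm{id}$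 and $\rho_{u\cdot v}\circ\rho_u=\rho_{v\cdot u}\circ\rho_v$ for all $u,v\in Y$. The semidirect product $X\rtimes_\rho Y$ is the L-algebra on $X\times Y$ with operation $(x,u)\cdot(y,v)=(\rho_{u\cdot v}(x)\cdot\rho_{v\cdot u}(y),\,u\cdot v)$. If $X,Y$ are CKL-algebras, $Y$ operates on $X$ via $\rho$ as CKL-algebras if in addition, for all $u,v\in Y$, $x,y\in X$: $x\cdot\rho_u(x)=1$, $\rho_u\rho_v=\rho_v\rho_u$, and $\rho_u(x\cdot y)=x\cdot\rho_u(y)$. The symmetric semidirect product is then the CKL-algebra (an L-subalgebra of $X\rtimes_\rho Y$) $X\bowtie_\rho Y=\{(x,u)\in X\rtimes_\rho Y\mid\rho_u(x)=x\}$. *)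

theory Defs
  imports "HOL-Algebra.Congruence"
begin

record 'a lalg = "'a partial_object" +
  lmul :: "'a \<Rightarrow> 'a \<Rightarrow> 'a" (infixl "\<cdot>\<index>" 70)
  lone :: 'a ("\<one>\<index>")

locale L_algebra =
  fixes A :: "('a, 'm) lalg_scheme" (structure)
  assumes one_closed: "\<one> \<in> carrier A"
    and mul_closed: "x \<in> carrier A \<Longrightarrow> y \<in> carrier A \<Longrightarrow> x \<cdot> y \<in> carrier A"
    and one_mul: "x \<in> carrier A \<Longrightarrow> \<one> \<cdot> x = x"
    and mul_one: "x \<in> carrier A \<Longrightarrow> x \<cdot> \<one> = \<one>"
    and mul_self: "x \<in> carrier A \<Longrightarrow> x \<cdot> x = \<one>"
    and mul_cycle: "x \<in> carrier A \<Longrightarrow> y \<in> carrier A \<Longrightarrow> z \<in> carrier A \<Longrightarrow>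
      (x \<cdot> y) \<cdot> (x \<cdot> z) = (y \<cdot> x) \<cdot> (y \<cdot> z)"
    and mul_antisym: "x \<in> carrier A \<Longrightarrow> y \<in> carrier A \<Longrightarrow>
      x \<cdot> y = \<one> \<Longrightarrow> y \<cdot> x = \<one> \<Longrightarrow> x = y"

locale CKL_algebra = L_algebra +
  assumes mul_exchange: "x \<in> carrier A \<Longrightarrow> y \<in> carrier A \<Longrightarrow> z \<in> carrier A \<Longrightarrow>
    x \<cdot> (y \<cdot> z) = y \<cdot> (x \<cdot> z)"

definition L_End :: "('a, 'm) lalg_scheme \<Rightarrow> ('a \<Rightarrow> 'a) set" where
  "L_End A = {f. (\<forall>x\<in>carrier A. f x \<in> carrier A) \<and>
     (\<forall>x\<in>carrier A. \<forall>y\<in>carrier A. f (x \<cdot>\<^bsub>A\<^esub> y) = f x \<cdot>\<^bsub>A\<^esub> f y)}"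

definition L_ideals :: "('a, 'm) lalg_scheme \<Rightarrow> 'a set set" where
  "L_ideals A = {I. I \<subseteq> carrier A \<and> I \<noteq> {} \<and>
     (\<forall>x\<in>I. \<forall>y\<in>carrier A.
        (x \<cdot>\<^bsub>A\<^esub> y \<in> I \<longrightarrow> y \<in> I) \<and>
        y \<cdot>\<^bsub>A\<^esub> x \<in> I \<and>
        (x \<cdot>\<^bsub>A\<^esub> y) \<cdot>\<^bsub>A\<^esub> y \<in> I \<and>
        y \<cdot>\<^bsub>A\<^esub> (x \<cdot>\<^bsub>A\<^esub> y) \<in> I)}"

text \<open>Members of \<^const>\<open>L_End\<close> are only constrained on the carrier, so identities between
  endomorphisms are stated pointwise on the carrier. For the same reason, the restriction of
  an operation to subalgebras is given by the same function \<open>\<rho>\<close>.\<close>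

locale L_operates = X: L_algebra X + Y: L_algebra Y
  for X :: "('a, 'm) lalg_scheme" and Y :: "('b, 'n) lalg_scheme" +
  fixes \<rho> :: "'b \<Rightarrow> 'a \<Rightarrow> 'a"
  assumes rho_End: "u \<in> carrier Y \<Longrightarrow> \<rho> u \<in> L_End X"
    and rho_one: "x \<in> carrier X \<Longrightarrow> \<rho> \<one>\<^bsub>Y\<^esub> x = x"
    and rho_cycle: "u \<in> carrier Y \<Longrightarrow> v \<in> carrier Y \<Longrightarrow> x \<in> carrier X \<Longrightarrow>
      \<rho> (u \<cdot>\<^bsub>Y\<^esub> v) (\<rho> u x) = \<rho> (v \<cdot>\<^bsub>Y\<^esub> u) (\<rho> v x)"

locale CKL_operates = L_operates X Y \<rho> + X: CKL_algebra X + Y: CKL_algebra Y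
  for X :: "('a, 'm) lalg_scheme" and Y :: "('b, 'n) lalg_scheme" and \<rho> +
  assumes rho_above: "u \<in> carrier Y \<Longrightarrow> x \<in> carrier X \<Longrightarrow> x \<cdot>\<^bsub>X\<^esub> \<rho> u x = \<one>\<^bsub>X\<^esub>"
    and rho_commute: "u \<in> carrier Y \<Longrightarrow> v \<in> carrier Y \<Longrightarrow> x \<in> carrier X \<Longrightarrow>
      \<rho> u (\<rho> v x) = \<rho> v (\<rho> u x)"
    and rho_mul: "u \<in> carrier Y \<Longrightarrow> x \<in> carrier X \<Longrightarrow> y \<in> carrier X \<Longrightarrow>
      \<rho> u (x \<cdot>\<^bsub>X\<^esub> y) = x \<cdot>\<^bsub>X\<^esub> \<rho> u y"

definition semidirect ::
  "('a, 'm) lalg_scheme \<Rightarrow> ('b, 'n) lalg_scheme \<Rightarrow> ('b \<Rightarrow> 'a \<Rightarrow> 'a) \<Rightarrow> ('a \<times> 'b) lalg" where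
  "semidirect X Y \<rho> =
     \<lparr>carrier = carrier X \<times> carrier Y,
      lmul = (\<lambda>(x, u) (y, v). (\<rho> (u \<cdot>\<^bsub>Y\<^esub> v) x \<cdot>\<^bsub>X\<^esub> \<rho> (v \<cdot>\<^bsub>Y\<^esub> u) y, u \<cdot>\<^bsub>Y\<^esub> v)),
      lone = (\<one>\<^bsub>X\<^esub>, \<one>\<^bsub>Y\<^esub>)\<rparr>"

definition L_restrict :: "('a, 'm) lalg_scheme \<Rightarrow> 'a set \<Rightarrow> ('a, 'm) lalg_scheme" where
  "L_restrict A S = A\<lparr>carrier := S\<rparr>"

definition sym_semidirect ::
  "('a, 'm) lalg_scheme \<Rightarrow> ('b, 'n) lalg_scheme \<Rightarrow> ('b \<Rightarrow> 'a \<Rightarrow> 'a) \<Rightarrow> ('a \<times> 'b) lalg" where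
  "sym_semidirect X Y \<rho> =
     L_restrict (semidirect X Y \<rho>) {(x, u) \<in> carrier (semidirect X Y \<rho>). \<rho> u x = x}"

definition X_part ::
  "('a, 'm) lalg_scheme \<Rightarrow> ('b, 'n) lalg_scheme \<Rightarrow> ('a \<times> 'b) set \<Rightarrow> 'a set" where
  "X_part X Y L = {x \<in> carrier X. (x, \<one>\<^bsub>Y\<^esub>) \<in> L}"

definition Y_part ::
  "('a, 'm) lalg_scheme \<Rightarrow> ('b, 'n) lalg_scheme \<Rightarrow> ('a \<times> 'b) set \<Rightarrow> 'b set" where
  "Y_part X Y L = {y \<in> carrier Y. (\<one>\<^bsub>X\<^esub>, y) \<in> L}"

definition tilde ::
  "('a, 'm) lalg_scheme \<Rightarrow> ('b, 'n) lalg_scheme \<Rightarrow> ('b \<Rightarrow> 'a \<Rightarrow> 'a) \<Rightarrow> ('a \<times> 'b) set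
    \<Rightarrow> ('a \<times> 'b) set" where
  "tilde X Y \<rho> L =
     carrier (semidirect (L_restrict X (X_part X Y L)) (L_restrict Y (Y_part X Y L)) \<rho>)"

context L_operates
begin

lemma rho_closed: "u \<in> carrier Y \<Longrightarrow> x \<in> carrier X \<Longrightarrow> \<rho> u x \<in> carrier X"
  using rho_End by (auto simp: L_End_def)

lemma rho_hom: "u \<in> carrier Y \<Longrightarrow> x \<in> carrier X \<Longrightarrow> y \<in> carrier X \<Longrightarrow>
    \<rho> u (x \<cdot>\<^bsub>X\<^esub> y) = \<rho> u x \<cdot>\<^bsub>X\<^esub> \<rho> u y"
  using rho_End by (auto simp: L_End_def)

lemma rho_of_one: "u \<in> carrier Y \<Longrightarrow> \<rho> u \<one>\<^bsub>X\<^esub> = \<one>\<^bsub>X\<^esub>"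
  by (metis rho_closed rho_hom X.one_closed X.mul_self)

lemmas closed = rho_closed X.one_closed X.mul_closed Y.one_closed Y.mul_closed

lemma semidirect_L_algebra: "L_algebra (semidirect X Y \<rho>)"
proof
  fix p q r assume "p \<in> carrier (semidirect X Y \<rho>)" "q \<in> carrier (semidirect X Y \<rho>)"
    "r \<in> carrier (semidirect X Y \<rho>)"
  then obtain x u y v z w where e: "p = (x, u)" "q = (y, v)" "r = (z, w)"
    and c: "x \<in> carrier X" "y \<in> carrier X" "z \<in> carrier X"
      "u \<in> carrier Y" "v \<in> carrier Y" "w \<in> carrier Y"
    by (auto simp: semidirect_def)
  let ?a = "(u \<cdot>\<^bsub>Y\<^esub> v) \<cdot>\<^bsub>Y\<^esub> (u \<cdot>\<^bsub>Y\<^esub> w)"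
  let ?X = "\<rho> ?a (\<rho> (u \<cdot>\<^bsub>Y\<^esub> v) x)" and ?Y = "\<rho> ?a (\<rho> (v \<cdot>\<^bsub>Y\<^esub> u) y)"
  let ?Z = "\<rho> ((w \<cdot>\<^bsub>Y\<^esub> u) \<cdot>\<^bsub>Y\<^esub> (w \<cdot>\<^bsub>Y\<^esub> v)) (\<rho> (w \<cdot>\<^bsub>Y\<^esub> u) z)"
  have a: "(v \<cdot>\<^bsub>Y\<^esub> u) \<cdot>\<^bsub>Y\<^esub> (v \<cdot>\<^bsub>Y\<^esub> w) = ?a"
    "(u \<cdot>\<^bsub>Y\<^esub> w) \<cdot>\<^bsub>Y\<^esub> (u \<cdot>\<^bsub>Y\<^esub> v) = (w \<cdot>\<^bsub>Y\<^esub> u) \<cdot>\<^bsub>Y\<^esub> (w \<cdot>\<^bsub>Y\<^esub> v)"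
    "(v \<cdot>\<^bsub>Y\<^esub> w) \<cdot>\<^bsub>Y\<^esub> (v \<cdot>\<^bsub>Y\<^esub> u) = (w \<cdot>\<^bsub>Y\<^esub> v) \<cdot>\<^bsub>Y\<^esub> (w \<cdot>\<^bsub>Y\<^esub> u)"
    by (simp_all add: c Y.mul_cycle)
  have x: "\<rho> ((w \<cdot>\<^bsub>Y\<^esub> u) \<cdot>\<^bsub>Y\<^esub> (w \<cdot>\<^bsub>Y\<^esub> v)) (\<rho> (u \<cdot>\<^bsub>Y\<^esub> w) x) = ?X"
    using rho_cycle[of "u \<cdot>\<^bsub>Y\<^esub> w" "u \<cdot>\<^bsub>Y\<^esub> v" x] c a by (simp add: closed)
  have y: "\<rho> ((w \<cdot>\<^bsub>Y\<^esub> v) \<cdot>\<^bsub>Y\<^esub> (w \<cdot>\<^bsub>Y\<^esub> u)) (\<rho> (v \<cdot>\<^bsub>Y\<^esub> w) y) = ?Y"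
    using rho_cycle[of "v \<cdot>\<^bsub>Y\<^esub> w" "v \<cdot>\<^bsub>Y\<^esub> u" y] c a by (simp add: closed)
  have z: "\<rho> ((w \<cdot>\<^bsub>Y\<^esub> v) \<cdot>\<^bsub>Y\<^esub> (w \<cdot>\<^bsub>Y\<^esub> u)) (\<rho> (w \<cdot>\<^bsub>Y\<^esub> v) z) = ?Z"
    using rho_cycle[of "w \<cdot>\<^bsub>Y\<^esub> v" "w \<cdot>\<^bsub>Y\<^esub> u" z] c by (simp add: closed)
  have XYZ: "(?X \<cdot>\<^bsub>X\<^esub> ?Y) \<cdot>\<^bsub>X\<^esub> (?X \<cdot>\<^bsub>X\<^esub> ?Z) = (?Y \<cdot>\<^bsub>X\<^esub> ?X) \<cdot>\<^bsub>X\<^esub> (?Y \<cdot>\<^bsub>X\<^esub> ?Z)"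
    by (rule X.mul_cycle) (simp_all add: c closed)
  show "(p \<cdot>\<^bsub>semidirect X Y \<rho>\<^esub> q) \<cdot>\<^bsub>semidirect X Y \<rho>\<^esub> (p \<cdot>\<^bsub>semidirect X Y \<rho>\<^esub> r) =
    (q \<cdot>\<^bsub>semidirect X Y \<rho>\<^esub> p) \<cdot>\<^bsub>semidirect X Y \<rho>\<^esub> (q \<cdot>\<^bsub>semidirect X Y \<rho>\<^esub> r)"
    by (simp add: e semidirect_def c closed rho_hom a x y z XYZ)
next
  fix p q assume "p \<in> carrier (semidirect X Y \<rho>)" "q \<in> carrier (semidirect X Y \<rho>)"
    "p \<cdot>\<^bsub>semidirect X Y \<rho>\<^esub> q = \<one>\<^bsub>semidirect X Y \<rho>\<^esub>"
    "q \<cdot>\<^bsub>semidirect X Y \<rho>\<^esub> p = \<one>\<^bsub>semidirect X Y \<rho>\<^esub>"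
  then show "p = q"
    by (auto simp: semidirect_def rho_one intro: X.mul_antisym dest: Y.mul_antisym)
qed (auto simp: semidirect_def closed rho_one rho_of_one X.one_mul X.mul_one X.mul_self
    Y.one_mul Y.mul_one Y.mul_self)

end

context CKL_operates
begin

lemma rho_idem:
  assumes "u \<in> carrier Y" "x \<in> carrier X"
  shows "\<rho> u (\<rho> u x) = \<rho> u x"
proof (rule X.mul_antisym)
  have "\<rho> u (\<rho> u x) \<cdot>\<^bsub>X\<^esub> \<rho> u x = \<rho> u (\<rho> u x \<cdot>\<^bsub>X\<^esub> x)"
    using assms by (simp add: rho_hom closed)
  also have "\<dots> = \<one>\<^bsub>X\<^esub>" using assms by (simp add: rho_mul closed X.mul_self)
  finally show "\<rho> u (\<rho> u x) \<cdot>\<^bsub>X\<^esub> \<rho> u x = \<one>\<^bsub>X\<^esub>" .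
qed (use assms in \<open>simp_all add: closed rho_above\<close>)

lemma sym_mul:
  assumes "x \<in> carrier X" "y \<in> carrier X" "u \<in> carrier Y" "v \<in> carrier Y" "\<rho> v y = y"
  shows "\<rho> (u \<cdot>\<^bsub>Y\<^esub> v) x \<cdot>\<^bsub>X\<^esub> \<rho> (v \<cdot>\<^bsub>Y\<^esub> u) y = x \<cdot>\<^bsub>X\<^esub> \<rho> (v \<cdot>\<^bsub>Y\<^esub> u) y"
proof -
  have y: "\<rho> (v \<cdot>\<^bsub>Y\<^esub> u) y = \<rho> (u \<cdot>\<^bsub>Y\<^esub> v) (\<rho> u y)"
    using rho_cycle[of v u y] assms by simp
  show ?thesis unfolding y using assms by (metis closed rho_hom rho_mul)
qed

lemma sym_closed:
  assumes "x \<in> carrier X" "y \<in> carrier X" "u \<in> carrier Y" "v \<in> carrier Y" "\<rho> v y = y"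
  shows "\<rho> (u \<cdot>\<^bsub>Y\<^esub> v) (x \<cdot>\<^bsub>X\<^esub> \<rho> (v \<cdot>\<^bsub>Y\<^esub> u) y) = x \<cdot>\<^bsub>X\<^esub> \<rho> (v \<cdot>\<^bsub>Y\<^esub> u) y"
proof -
  have y: "\<rho> (v \<cdot>\<^bsub>Y\<^esub> u) y = \<rho> (u \<cdot>\<^bsub>Y\<^esub> v) (\<rho> u y)"
    using rho_cycle[of v u y] assms by simp
  show ?thesis unfolding y using assms by (simp add: closed rho_mul rho_idem)
qed

lemma sym_semidirect_CKL_algebra: "CKL_algebra (sym_semidirect X Y \<rho>)"
proof -
  interpret S: L_algebra "semidirect X Y \<rho>" by (rule semidirect_L_algebra)
  let ?T = "sym_semidirect X Y \<rho>"
  have sub: "p \<in> carrier ?T \<Longrightarrow> p \<in> carrier (semidirect X Y \<rho>)" for p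
    by (auto simp: sym_semidirect_def L_restrict_def)
  have ops: "lmul ?T = lmul (semidirect X Y \<rho>)" "lone ?T = lone (semidirect X Y \<rho>)"
    by (simp_all add: sym_semidirect_def L_restrict_def)
  show ?thesis
  proof
    fix p q r assume "p \<in> carrier ?T" "q \<in> carrier ?T" "r \<in> carrier ?T"
    then obtain x u y v z w where e: "p = (x, u)" "q = (y, v)" "r = (z, w)"
      and c: "x \<in> carrier X" "y \<in> carrier X" "z \<in> carrier X"
        "u \<in> carrier Y" "v \<in> carrier Y" "w \<in> carrier Y"
      and f: "\<rho> u x = x" "\<rho> v y = y" "\<rho> w z = z"
      by (auto simp: sym_semidirect_def L_restrict_def semidirect_def)
    have key: "\<rho> ((v \<cdot>\<^bsub>Y\<^esub> w) \<cdot>\<^bsub>Y\<^esub> u) (\<rho> (w \<cdot>\<^bsub>Y\<^esub> v) z) =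
        \<rho> (u \<cdot>\<^bsub>Y\<^esub> (v \<cdot>\<^bsub>Y\<^esub> w)) (\<rho> u (\<rho> v z))"
      if "u \<in> carrier Y" "v \<in> carrier Y" for u v
      using rho_cycle[of w v z] rho_cycle[of "v \<cdot>\<^bsub>Y\<^esub> w" u "\<rho> v z"] that c f
      by (simp add: closed)
    have fst_mul: "p \<cdot>\<^bsub>?T\<^esub> (q \<cdot>\<^bsub>?T\<^esub> r) =
        (x \<cdot>\<^bsub>X\<^esub> (y \<cdot>\<^bsub>X\<^esub> \<rho> (u \<cdot>\<^bsub>Y\<^esub> (v \<cdot>\<^bsub>Y\<^esub> w)) (\<rho> u (\<rho> v z))), u \<cdot>\<^bsub>Y\<^esub> (v \<cdot>\<^bsub>Y\<^esub> w))"
      if "p = (x, u)" "q = (y, v)" "x \<in> carrier X" "y \<in> carrier X"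
        "u \<in> carrier Y" "v \<in> carrier Y" for p q x y u v
    proof -
      have "\<rho> (u \<cdot>\<^bsub>Y\<^esub> (v \<cdot>\<^bsub>Y\<^esub> w)) x \<cdot>\<^bsub>X\<^esub> \<rho> ((v \<cdot>\<^bsub>Y\<^esub> w) \<cdot>\<^bsub>Y\<^esub> u) (y \<cdot>\<^bsub>X\<^esub> \<rho> (w \<cdot>\<^bsub>Y\<^esub> v) z) =
          x \<cdot>\<^bsub>X\<^esub> \<rho> ((v \<cdot>\<^bsub>Y\<^esub> w) \<cdot>\<^bsub>Y\<^esub> u) (y \<cdot>\<^bsub>X\<^esub> \<rho> (w \<cdot>\<^bsub>Y\<^esub> v) z)"
        by (rule sym_mul) (use that c f in \<open>simp_all add: closed sym_closed\<close>)
      also have "\<dots> = x \<cdot>\<^bsub>X\<^esub> (y \<cdot>\<^bsub>X\<^esub> \<rho> (u \<cdot>\<^bsub>Y\<^esub> (v \<cdot>\<^bsub>Y\<^esub> w)) (\<rho> u (\<rho> v z)))"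
        using that c by (simp add: rho_mul closed key)
      finally show ?thesis using that c f e(3) by (simp add: ops semidirect_def sym_mul)
    qed
    have "\<rho> u (\<rho> v z) = \<rho> v (\<rho> u z)" "u \<cdot>\<^bsub>Y\<^esub> (v \<cdot>\<^bsub>Y\<^esub> w) = v \<cdot>\<^bsub>Y\<^esub> (u \<cdot>\<^bsub>Y\<^esub> w)"
      using c by (simp_all add: rho_commute Y.mul_exchange)
    then show "p \<cdot>\<^bsub>?T\<^esub> (q \<cdot>\<^bsub>?T\<^esub> r) = q \<cdot>\<^bsub>?T\<^esub> (p \<cdot>\<^bsub>?T\<^esub> r)"
      using c fst_mul[OF e(1,2)] fst_mul[OF e(2,1)]
        X.mul_exchange[of x y "\<rho> (v \<cdot>\<^bsub>Y\<^esub> (u \<cdot>\<^bsub>Y\<^esub> w)) (\<rho> v (\<rho> u z))"]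
      by (simp add: closed)
  next
    fix p q assume "p \<in> carrier ?T" "q \<in> carrier ?T"
    then show "p \<cdot>\<^bsub>?T\<^esub> q \<in> carrier ?T"
      by (auto simp: sym_semidirect_def L_restrict_def semidirect_def closed sym_mul sym_closed)
  next
    show "\<one>\<^bsub>?T\<^esub> \<in> carrier ?T"
      by (auto simp: sym_semidirect_def L_restrict_def semidirect_def closed rho_one)
  next
    fix p q assume "p \<in> carrier ?T" "q \<in> carrier ?T"
      "p \<cdot>\<^bsub>?T\<^esub> q = \<one>\<^bsub>?T\<^esub>" "q \<cdot>\<^bsub>?T\<^esub> p = \<one>\<^bsub>?T\<^esub>"
    then show "p = q" using S.mul_antisym sub by (simp only: ops)
  qed (simp_all only: ops sub S.one_mul S.mul_one S.mul_self S.mul_cycle)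
qed

end

end

theory Submission
  imports Defs
begin

text \<open>For any \<open>(x, u)\<close> in the semidirect product, \<open>(x, u) \<cdot> (x, 1) = (x, u) \<cdot> (1, u) = 1\<close> and
  \<open>(1, u) \<cdot> (x, u) = (x, 1)\<close>. Hence an ideal of either product contains \<open>(x, u)\<close> if and only if it
  contains \<open>(x, 1)\<close> and \<open>(1, u)\<close>, and both of these always lie in the symmetric product. The only
  real work is that \<open>L\<^sub>X \<times> L\<^sub>Y\<close> is an ideal. Since \<open>(1, w) \<cdot> (y, 1) = (\<rho>\<^sub>w y, 1)\<close>, for \<open>w \<in> L\<^sub>Y\<close>
  the condition \<open>\<rho>\<^sub>w y \<in> L\<^sub>X\<close> already forces \<open>y \<in> L\<^sub>X\<close>; as \<open>\<rho>\<^sub>w (c \<cdot> y) = c \<cdot> \<rho>\<^sub>w y\<close>, this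
  reduces (I1) and (I3) to the corresponding conditions for \<open>L\<^sub>X\<close>.\<close>

section \<open>Ideals of one L-algebra, and ideals along homomorphisms\<close>

lemma L_ideals_I:
  assumes "I \<subseteq> carrier A" "I \<noteq> {}"
    and "\<And>x y. x \<in> I \<Longrightarrow> y \<in> carrier A \<Longrightarrow> x \<cdot>\<^bsub>A\<^esub> y \<in> I \<Longrightarrow> y \<in> I"
    and "\<And>x y. x \<in> I \<Longrightarrow> y \<in> carrier A \<Longrightarrow> y \<cdot>\<^bsub>A\<^esub> x \<in> I"
    and "\<And>x y. x \<in> I \<Longrightarrow> y \<in> carrier A \<Longrightarrow> (x \<cdot>\<^bsub>A\<^esub> y) \<cdot>\<^bsub>A\<^esub> y \<in> I"
    and "\<And>x y. x \<in> I \<Longrightarrow> y \<in> carrier A \<Longrightarrow> y \<cdot>\<^bsub>A\<^esub> (x \<cdot>\<^bsub>A\<^esub> y) \<in> I"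
  shows "I \<in> L_ideals A"
  unfolding L_ideals_def mem_Collect_eq
  by (intro conjI ballI impI; (rule assms(1,2) | rule assms(4); assumption | rule assms(5); assumption
    | rule assms(6); assumption | rule assms(3); assumption))

lemma L_ideals_D:
  assumes "I \<in> L_ideals A"
  shows L_ideals_subset: "x \<in> I \<Longrightarrow> x \<in> carrier A"
    and L_ideals_mp: "x \<in> I \<Longrightarrow> y \<in> carrier A \<Longrightarrow> x \<cdot>\<^bsub>A\<^esub> y \<in> I \<Longrightarrow> y \<in> I"
    and L_ideals_mul: "x \<in> I \<Longrightarrow> y \<in> carrier A \<Longrightarrow> y \<cdot>\<^bsub>A\<^esub> x \<in> I"
    and L_ideals_mul_mul: "x \<in> I \<Longrightarrow> y \<in> carrier A \<Longrightarrow> (x \<cdot>\<^bsub>A\<^esub> y) \<cdot>\<^bsub>A\<^esub> y \<in> I"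
    and L_ideals_nonempty: "\<exists>x. x \<in> I"
  using assms unfolding L_ideals_def by blast+

context L_algebra
begin

lemma one_in_L_ideal:
  assumes "I \<in> L_ideals A"
  shows "\<one> \<in> I"
proof -
  obtain x where x: "x \<in> I" using L_ideals_nonempty[OF assms] by blast
  then have "x \<cdot> x = \<one>" using L_ideals_subset[OF assms] by (simp add: mul_self)
  then show ?thesis using L_ideals_mul[OF assms x L_ideals_subset[OF assms x]] by simp
qed

text \<open>Since \<open>\<one>\<close> lies in \<open>I\<close>, (I1) applies: ideals are up-sets
  for the order in which \<open>x \<le> y\<close> means \<open>x \<cdot> y = \<one>\<close>.\<close>

lemma L_ideal_upward:
  assumes "I \<in> L_ideals A" "x \<in> I" "y \<in> carrier A" "x \<cdot> y = \<one>"
  shows "y \<in> I"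
  using L_ideals_mp[OF assms(1-3)] one_in_L_ideal[OF assms(1)] assms(4) by simp

text \<open>Closure under the operation comes from (I2), and the identities are inherited. This
  makes the factors of \<open>tilde\<close> L-algebras.\<close>

lemma L_restrict_ideal:
  assumes "I \<in> L_ideals A"
  shows "L_algebra (L_restrict A I)"
proof -
  note sub = L_ideals_subset[OF assms]
  show ?thesis
    by unfold_locales
      (auto simp: L_restrict_def sub one_in_L_ideal[OF assms] L_ideals_mul[OF assms]
        one_mul mul_one mul_self mul_cycle intro: mul_antisym)
qed

end

text \<open>A homomorphism preserves the unit because \<open>\<one> = \<one> \<cdot> \<one>\<close>,
  and (I1) to (I4) then pull back directly. Used for the embeddings of both factors into the
  symmetric product and for its inclusion in the semidirect product.\<close>

lemma L_ideals_preimage: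
  assumes A: "L_algebra A" and B: "L_algebra B" and I: "I \<in> L_ideals B"
    and f: "\<And>x. x \<in> carrier A \<Longrightarrow> f x \<in> carrier B"
      "\<And>x y. x \<in> carrier A \<Longrightarrow> y \<in> carrier A \<Longrightarrow> f (x \<cdot>\<^bsub>A\<^esub> y) = f x \<cdot>\<^bsub>B\<^esub> f y"
  shows "{x \<in> carrier A. f x \<in> I} \<in> L_ideals A"
proof -
  interpret A: L_algebra A by (rule A)
  interpret B: L_algebra B by (rule B)
  have "f \<one>\<^bsub>A\<^esub> = f \<one>\<^bsub>A\<^esub> \<cdot>\<^bsub>B\<^esub> f \<one>\<^bsub>A\<^esub>"
    by (metis A.one_closed A.mul_self f(2))
  also have "\<dots> = \<one>\<^bsub>B\<^esub>" by (simp add: A.one_closed f(1) B.mul_self)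
  finally have "f \<one>\<^bsub>A\<^esub> \<in> I" using B.one_in_L_ideal[OF I] by simp
  then have "{x \<in> carrier A. f x \<in> I} \<noteq> {}" using A.one_closed by blast
  then show ?thesis using I f A.mul_closed unfolding L_ideals_def by auto
qed

lemma sym_semidirect_sel [simp]:
  "lmul (sym_semidirect X Y \<rho>) = lmul (semidirect X Y \<rho>)"
  "lone (sym_semidirect X Y \<rho>) = lone (semidirect X Y \<rho>)"
  by (simp_all add: sym_semidirect_def L_restrict_def)

lemma carrier_sym_semidirect_iff:
  "(x, u) \<in> carrier (sym_semidirect X Y \<rho>) \<longleftrightarrow> x \<in> carrier X \<and> u \<in> carrier Y \<and> \<rho> u x = x"
  by (auto simp: sym_semidirect_def L_restrict_def semidirect_def)

lemma carrier_semidirect_iff: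
  "(x, u) \<in> carrier (semidirect X Y \<rho>) \<longleftrightarrow> x \<in> carrier X \<and> u \<in> carrier Y"
  by (simp add: semidirect_def)

lemma mul_semidirect:
  "(x, u) \<cdot>\<^bsub>semidirect X Y \<rho>\<^esub> (y, v) = (\<rho> (u \<cdot>\<^bsub>Y\<^esub> v) x \<cdot>\<^bsub>X\<^esub> \<rho> (v \<cdot>\<^bsub>Y\<^esub> u) y, u \<cdot>\<^bsub>Y\<^esub> v)"
  by (simp add: semidirect_def)

lemma one_semidirect: "\<one>\<^bsub>semidirect X Y \<rho>\<^esub> = (\<one>\<^bsub>X\<^esub>, \<one>\<^bsub>Y\<^esub>)"
  by (simp add: semidirect_def)

lemma tilde_eq: "tilde X Y \<rho> L = X_part X Y L \<times> Y_part X Y L"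
  by (simp add: tilde_def semidirect_def L_restrict_def)

section \<open>Ideals of the two products and their coordinate parts\<close>

context CKL_operates
begin

abbreviation "S \<equiv> semidirect X Y \<rho>"
abbreviation "T \<equiv> sym_semidirect X Y \<rho>"

sublocale S: L_algebra S
  by (rule semidirect_L_algebra)

sublocale T: CKL_algebra T
  by (rule sym_semidirect_CKL_algebra)

lemmas product_simps = mul_semidirect one_semidirect carrier_semidirect_iff
  carrier_sym_semidirect_iff closed rho_one rho_of_one rho_above
  X.one_mul X.mul_one X.mul_self Y.one_mul Y.mul_one Y.mul_self

lemma semidirect_ideal_iff:
  assumes K: "K \<in> L_ideals S" and c: "x \<in> carrier X" "u \<in> carrier Y"
  shows "(x, u) \<in> K \<longleftrightarrow> (x, \<one>\<^bsub>Y\<^esub>) \<in> K \<and> (\<one>\<^bsub>X\<^esub>, u) \<in> K"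
proof (intro iffI conjI)
  assume m: "(x, u) \<in> K"
  show "(x, \<one>\<^bsub>Y\<^esub>) \<in> K" "(\<one>\<^bsub>X\<^esub>, u) \<in> K"
    by (rule S.L_ideal_upward[OF K m]; simp add: product_simps c)+
next
  assume "(x, \<one>\<^bsub>Y\<^esub>) \<in> K \<and> (\<one>\<^bsub>X\<^esub>, u) \<in> K"
  then show "(x, u) \<in> K"
    using L_ideals_mp[OF K, of "(\<one>\<^bsub>X\<^esub>, u)" "(x, u)"] by (simp add: product_simps c)
qed

lemma sym_semidirect_ideal_iff:
  assumes L: "L \<in> L_ideals T" and c: "x \<in> carrier X" "u \<in> carrier Y" "\<rho> u x = x"
  shows "(x, u) \<in> L \<longleftrightarrow> (x, \<one>\<^bsub>Y\<^esub>) \<in> L \<and> (\<one>\<^bsub>X\<^esub>, u) \<in> L"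
proof (intro iffI conjI)
  assume m: "(x, u) \<in> L"
  show "(x, \<one>\<^bsub>Y\<^esub>) \<in> L" "(\<one>\<^bsub>X\<^esub>, u) \<in> L"
    by (rule T.L_ideal_upward[OF L m]; simp add: product_simps c)+
next
  assume "(x, \<one>\<^bsub>Y\<^esub>) \<in> L \<and> (\<one>\<^bsub>X\<^esub>, u) \<in> L"
  then show "(x, u) \<in> L"
    using L_ideals_mp[OF L, of "(\<one>\<^bsub>X\<^esub>, u)" "(x, u)"] by (simp add: product_simps c)
qed

text \<open>Preimage of \<open>L\<close> under \<open>x \<mapsto> (x, 1)\<close>, a homomorphism
  into \<open>T\<close> because \<open>\<rho> 1\<close> is the identity.\<close>

lemma X_part_ideal:
  assumes "L \<in> L_ideals T"
  shows "X_part X Y L \<in> L_ideals X"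
  unfolding X_part_def
  by (rule L_ideals_preimage[OF X.L_algebra_axioms T.L_algebra_axioms assms])
    (simp_all add: product_simps)

text \<open>Preimage of \<open>L\<close> under \<open>y \<mapsto> (1, y)\<close>, a homomorphism
  into \<open>T\<close> because every \<open>\<rho> u\<close> fixes \<open>1\<close>.\<close>

lemma Y_part_ideal:
  assumes "L \<in> L_ideals T"
  shows "Y_part X Y L \<in> L_ideals Y"
  unfolding Y_part_def
  by (rule L_ideals_preimage[OF Y.L_algebra_axioms T.L_algebra_axioms assms])
    (simp_all add: product_simps)

lemma restrict_semidirect_ideal:
  assumes "K \<in> L_ideals S"
  shows "K \<inter> carrier T \<in> L_ideals T"
proof -
  have "{p \<in> carrier T. p \<in> K} \<in> L_ideals T"
    by (rule L_ideals_preimage[OF T.L_algebra_axioms S.L_algebra_axioms assms])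
      (auto simp: product_simps)
  then show ?thesis by (simp add: Int_def conj_commute)
qed

text \<open>By \<open>rho_above\<close>, \<open>x \<le> \<rho> u x\<close>, and ideals are up-sets.
  Having this for all \<open>u\<close> of \<open>Y\<close> matters in \<open>tilde_ideal\<close>,
  where it is applied to \<open>u \<cdot> v\<close> with \<open>v\<close> arbitrary.\<close>

lemma rho_X_part:
  assumes L: "L \<in> L_ideals T" and "x \<in> X_part X Y L" "u \<in> carrier Y"
  shows "\<rho> u x \<in> X_part X Y L"
proof -
  have "x \<in> carrier X" using assms(2) by (simp add: X_part_def)
  then show ?thesis
    using X.L_ideal_upward[OF X_part_ideal[OF L] assms(2)] assms(3) by (simp add: product_simps)
qed

lemma rho_X_part_cancel:
  assumes L: "L \<in> L_ideals T" and "w \<in> Y_part X Y L" "y \<in> carrier X" "\<rho> w y \<in> X_part X Y L"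
  shows "y \<in> X_part X Y L"
  using L_ideals_mp[OF L, of "(\<one>\<^bsub>X\<^esub>, w)" "(y, \<one>\<^bsub>Y\<^esub>)"] assms
  by (simp add: X_part_def Y_part_def product_simps)

text \<open>The invariance \<open>rho_X_part\<close> makes \<open>\<rho>\<close> restrict, so that
  \<open>tilde\<close> is a genuine semidirect product of subalgebras.\<close>

lemma parts_L_operates:
  assumes L: "L \<in> L_ideals T"
  shows "L_operates (L_restrict X (X_part X Y L)) (L_restrict Y (Y_part X Y L)) \<rho>"
proof -
  note IX = X_part_ideal[OF L] and IY = Y_part_ideal[OF L]
  interpret X': L_algebra "L_restrict X (X_part X Y L)" by (rule X.L_restrict_ideal[OF IX])
  interpret Y': L_algebra "L_restrict Y (Y_part X Y L)" by (rule Y.L_restrict_ideal[OF IY])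
  note sub = L_ideals_subset[OF IX] L_ideals_subset[OF IY]
  show ?thesis
    by unfold_locales
      (auto simp: L_restrict_def L_End_def sub rho_X_part[OF L] rho_hom rho_one rho_cycle)
qed

lemma tilde_ideal:
  assumes L: "L \<in> L_ideals T"
  shows "tilde X Y \<rho> L \<in> L_ideals S"
  unfolding tilde_eq
proof (rule L_ideals_I)
  let ?LX = "X_part X Y L" and ?LY = "Y_part X Y L"
  note IX = X_part_ideal[OF L] and IY = Y_part_ideal[OF L]
  note subX = L_ideals_subset[OF IX] and subY = L_ideals_subset[OF IY]
  show "?LX \<times> ?LY \<subseteq> carrier S" using subX subY by (auto simp: semidirect_def)
  show "?LX \<times> ?LY \<noteq> {}" using X.one_in_L_ideal[OF IX] Y.one_in_L_ideal[OF IY] by blast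
  fix p q assume "p \<in> ?LX \<times> ?LY" "q \<in> carrier S"
  then obtain x u y v where e: "p = (x, u)" "q = (y, v)"
    and m: "x \<in> ?LX" "u \<in> ?LY" and cq: "y \<in> carrier X" "v \<in> carrier Y"
    by (auto simp: semidirect_def)
  note c = cq subX[OF m(1)] subY[OF m(2)]
  \<comment> \<open>This puts \<open>\<rho> (v \<cdot> u)\<close> among the maps that
    \<open>rho_X_part_cancel\<close> can strip, although \<open>v\<close> is arbitrary.\<close>
  have vu: "v \<cdot>\<^bsub>Y\<^esub> u \<in> ?LY" using L_ideals_mul[OF IY m(2) cq(2)] .
  show "q \<in> ?LX \<times> ?LY" if "p \<cdot>\<^bsub>S\<^esub> q \<in> ?LX \<times> ?LY"
  proof -
    have *: "\<rho> (u \<cdot>\<^bsub>Y\<^esub> v) x \<cdot>\<^bsub>X\<^esub> \<rho> (v \<cdot>\<^bsub>Y\<^esub> u) y \<in> ?LX" "u \<cdot>\<^bsub>Y\<^esub> v \<in> ?LY"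
      using that by (simp_all add: e mul_semidirect)
    have "v \<in> ?LY" using L_ideals_mp[OF IY m(2) cq(2) *(2)] .
    moreover have "\<rho> (v \<cdot>\<^bsub>Y\<^esub> u) y \<in> ?LX"
      using L_ideals_mp[OF IX rho_X_part[OF L m(1)] _ *(1)] c by (simp add: closed)
    then have "y \<in> ?LX" using rho_X_part_cancel[OF L vu cq(1)] by simp
    ultimately show ?thesis by (simp add: e)
  qed
  show "q \<cdot>\<^bsub>S\<^esub> p \<in> ?LX \<times> ?LY"
    using vu L_ideals_mul[OF IX rho_X_part[OF L m(1)]] c by (simp add: e mul_semidirect closed)
  \<comment> \<open>\<open>w\<close> is the second coordinate of
    \<open>(p \<cdot> q) \<cdot> q\<close>; \<open>a\<close> and \<open>b\<close> are the images
    under \<open>\<rho> w\<close> of the two factors in the first coordinate of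
    \<open>p \<cdot> q\<close>.\<close>
  define w where "w = (u \<cdot>\<^bsub>Y\<^esub> v) \<cdot>\<^bsub>Y\<^esub> v"
  define a where "a = \<rho> w (\<rho> (u \<cdot>\<^bsub>Y\<^esub> v) x)"
  define b where "b = \<rho> w (\<rho> (v \<cdot>\<^bsub>Y\<^esub> u) y)"
  have w: "w \<in> ?LY" unfolding w_def using L_ideals_mul_mul[OF IY m(2) cq(2)] .
  have cw: "w \<in> carrier Y" using subY[OF w] .
  have a: "a \<in> ?LX" unfolding a_def using c cw by (simp add: rho_X_part[OF L] m(1) closed)
  have ca: "a \<in> carrier X" using subX[OF a] .
  have cb: "b \<in> carrier X" unfolding b_def using c cw by (simp add: closed)
  \<comment> \<open>Hence the outer action on \<open>y\<close> is \<open>\<rho> 1\<close>, the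
    identity: the first coordinates for (I3) and (I4) are \<open>(a \<cdot> b) \<cdot> y\<close> and
    \<open>y \<cdot> (a \<cdot> b)\<close>.\<close>
  have v: "v \<cdot>\<^bsub>Y\<^esub> (u \<cdot>\<^bsub>Y\<^esub> v) = \<one>\<^bsub>Y\<^esub>"
    using c Y.mul_exchange[of v u v] by (simp add: Y.mul_self Y.mul_one)
  have ab: "\<rho> w (\<rho> (u \<cdot>\<^bsub>Y\<^esub> v) x \<cdot>\<^bsub>X\<^esub> \<rho> (v \<cdot>\<^bsub>Y\<^esub> u) y) = a \<cdot>\<^bsub>X\<^esub> b"
    unfolding a_def b_def using c cw by (simp add: rho_hom closed)
  show "(p \<cdot>\<^bsub>S\<^esub> q) \<cdot>\<^bsub>S\<^esub> q \<in> ?LX \<times> ?LY"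
  proof -
    \<comment> \<open>By \<open>rho_mul\<close> both maps act on the last factor alone and turn
      \<open>y\<close> into \<open>b\<close>, where (I3) for the ideal of \<open>X\<close> applies;
      afterwards the maps are cancelled one at a time.\<close>
    have "\<rho> w (\<rho> (v \<cdot>\<^bsub>Y\<^esub> u) ((a \<cdot>\<^bsub>X\<^esub> b) \<cdot>\<^bsub>X\<^esub> y)) = (a \<cdot>\<^bsub>X\<^esub> b) \<cdot>\<^bsub>X\<^esub> b"
      using c cw ca cb by (simp add: rho_mul closed b_def)
    then have "\<rho> w (\<rho> (v \<cdot>\<^bsub>Y\<^esub> u) ((a \<cdot>\<^bsub>X\<^esub> b) \<cdot>\<^bsub>X\<^esub> y)) \<in> ?LX"
      using L_ideals_mul_mul[OF IX a cb] by simp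
    then have "\<rho> (v \<cdot>\<^bsub>Y\<^esub> u) ((a \<cdot>\<^bsub>X\<^esub> b) \<cdot>\<^bsub>X\<^esub> y) \<in> ?LX"
      using rho_X_part_cancel[OF L w] c ca cb by (simp add: closed)
    then have "(a \<cdot>\<^bsub>X\<^esub> b) \<cdot>\<^bsub>X\<^esub> y \<in> ?LX"
      using rho_X_part_cancel[OF L vu] c ca cb by (simp add: closed)
    then show ?thesis
      using w v ab c by (simp add: e mul_semidirect w_def[symmetric] rho_one)
  qed
  show "q \<cdot>\<^bsub>S\<^esub> (p \<cdot>\<^bsub>S\<^esub> q) \<in> ?LX \<times> ?LY"
  proof -
    \<comment> \<open>Applying \<open>\<rho> w\<close> to
      \<open>y \<cdot> \<rho> (v \<cdot> u) y = 1\<close> gives \<open>y \<le> b\<close> by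
      \<open>rho_mul\<close>. Exchange then yields
      \<open>y \<cdot> (a \<cdot> b) = a \<cdot> (y \<cdot> b) = 1\<close>, so the (I4) product is
      the unit of \<open>S\<close>.\<close>
    have "y \<cdot>\<^bsub>X\<^esub> b = \<one>\<^bsub>X\<^esub>"
      using c cw X.mul_self rho_mul[of w y "\<rho> (v \<cdot>\<^bsub>Y\<^esub> u) y"] by (simp add: b_def closed rho_above rho_of_one)
    then have "y \<cdot>\<^bsub>X\<^esub> (a \<cdot>\<^bsub>X\<^esub> b) = \<one>\<^bsub>X\<^esub>"
      using X.mul_exchange[OF cq(1) ca cb] ca by (simp add: X.mul_one)
    then show ?thesis
      using v ab c X.one_in_L_ideal[OF IX] Y.one_in_L_ideal[OF IY]
      by (simp add: e mul_semidirect w_def[symmetric] rho_one)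
  qed
qed

section \<open>The two assignments undo each other\<close>

lemma tilde_restrict:
  assumes "L \<in> L_ideals T"
  shows "tilde X Y \<rho> L \<inter> carrier T = L"
  unfolding set_eq_iff split_paired_All
proof (intro allI)
  fix x u
  show "(x, u) \<in> tilde X Y \<rho> L \<inter> carrier T \<longleftrightarrow> (x, u) \<in> L"
  proof (cases "(x, u) \<in> carrier T")
    case True
    then have c: "x \<in> carrier X" "u \<in> carrier Y" "\<rho> u x = x"
      by (simp_all add: carrier_sym_semidirect_iff)
    with True show ?thesis
      unfolding sym_semidirect_ideal_iff[OF assms c]
      by (simp add: tilde_eq X_part_def Y_part_def)
  next
    case False
    then show ?thesis using L_ideals_subset[OF assms] by blast
  qed
qed

text \<open>Intersecting with \<open>carrier T\<close> keeps every \<open>(x, 1)\<close> and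
  \<open>(1, u)\<close> in \<open>K\<close>, and these determine \<open>K\<close> by
  \<open>semidirect_ideal_iff\<close>.\<close>

lemma restrict_tilde:
  assumes "K \<in> L_ideals S"
  shows "tilde X Y \<rho> (K \<inter> carrier T) = K"
  unfolding set_eq_iff split_paired_All
proof (intro allI)
  fix x u
  show "(x, u) \<in> tilde X Y \<rho> (K \<inter> carrier T) \<longleftrightarrow> (x, u) \<in> K"
  proof (cases "(x, u) \<in> carrier S")
    case True
    then have c: "x \<in> carrier X" "u \<in> carrier Y"
      by (simp_all add: carrier_semidirect_iff)
    then show ?thesis
      unfolding semidirect_ideal_iff[OF assms c]
      by (simp add: tilde_eq X_part_def Y_part_def product_simps)
  next
    case False
    then have "(x, u) \<notin> K" using L_ideals_subset[OF assms] by blast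
    moreover have "(x, u) \<notin> tilde X Y \<rho> (K \<inter> carrier T)"
      using False by (auto simp: tilde_eq X_part_def Y_part_def carrier_semidirect_iff)
    ultimately show ?thesis by simp
  qed
qed

end

theorem proposition3p20:
  fixes X :: "('a, 'm) lalg_scheme" and Y :: "('b, 'n) lalg_scheme"
    and \<rho> :: "'b \<Rightarrow> 'a \<Rightarrow> 'a"
  assumes "CKL_algebra X" and "CKL_algebra Y" and "CKL_operates X Y \<rho>"
  shows "(\<forall>L \<in> L_ideals (sym_semidirect X Y \<rho>).
            L_operates (L_restrict X (X_part X Y L)) (L_restrict Y (Y_part X Y L)) \<rho> \<and>
            tilde X Y \<rho> L = X_part X Y L \<times> Y_part X Y L) \<and>
         bij_betw (tilde X Y \<rho>)
           (L_ideals (sym_semidirect X Y \<rho>)) (L_ideals (semidirect X Y \<rho>)) \<and>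
         bij_betw (\<lambda>K. K \<inter> carrier (sym_semidirect X Y \<rho>))
           (L_ideals (semidirect X Y \<rho>)) (L_ideals (sym_semidirect X Y \<rho>)) \<and>
         (\<forall>L \<in> L_ideals (sym_semidirect X Y \<rho>).
            tilde X Y \<rho> L \<inter> carrier (sym_semidirect X Y \<rho>) = L) \<and>
         (\<forall>K \<in> L_ideals (semidirect X Y \<rho>).
            tilde X Y \<rho> (K \<inter> carrier (sym_semidirect X Y \<rho>)) = K)"
proof -
  interpret CKL_operates X Y \<rho> by (rule assms)
  have "bij_betw (tilde X Y \<rho>) (L_ideals T) (L_ideals S)"
    by (rule bij_betw_byWitness[where f' = "\<lambda>K. K \<inter> carrier T"])
      (auto simp: tilde_restrict restrict_tilde tilde_ideal restrict_semidirect_ideal)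
  moreover have "bij_betw (\<lambda>K. K \<inter> carrier T) (L_ideals S) (L_ideals T)"
    by (rule bij_betw_byWitness[where f' = "tilde X Y \<rho>"])
      (auto simp: tilde_restrict restrict_tilde tilde_ideal restrict_semidirect_ideal)
  ultimately show ?thesis
    by (simp add: parts_L_operates tilde_eq[of X Y \<rho>, symmetric] tilde_restrict restrict_tilde)
qed

end
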